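(* Let $(X,\|\cdot\|)$ be a Banach space and let $I\in C^1(X,\mathbb{R})$ be a functional of the form $I(u)=A(u)-B(u)$ for all $u\in X$, satisfying conditions (A) and ($\Psi$) stated in the context, with $\{\psi_n\}\subset C(X,X)$ the sequence of mappings in ($\Psi$). Suppose that there exist $r>0$ and $\bar u\in X$ with $\|\bar u\|>r$ such that $$\inf_{\|u\|=r} I(u)>I(0)\ge I(\bar u)\qquad\text{and}\qquad \lim_{n\to\infty}\|\psi_n(0)\|=\lim_{n\to\infty}\|\psi_n(\bar u)-\bar u\|=0.$$ Define $$c:=\inf_{\gamma\in\Gamma}\max_{u\in\gamma([0,1])}I(u),\qquad \Gamma:=\{\gamma\in C([0,1],X):\gamma(0)=0,\ \gamma(1)=\bar u\}.$$ Then there exists a sequence $\{w_n\}\subset X$ such that $$I(w_n)\to c,\qquad I'(w_n)\to 0\ \text{in } X',\qquad \sup_n A(w_n)<\infty.$$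
   Context: $X'$ denotes the dual space of $X$, $C(X,X)$ is the set of continuous maps $X\to X$, and $A,B:X\to\mathbb{R}$ are functions. For $l\in\mathbb{R}$ put $A^{l}:=\{u\in X:A(u)\le l\}$, and $\mathrm{dist}(u,A^{l}):=\inf_{h\in A^{l}}\|u-h\|$. Condition (A): $A$ is nonnegative and for all $l_2>l_1>0$ there exists $\delta_{l_1,l_2}>0$ such that for all $u\in X$, $\mathrm{dist}(u,A^{l_1})\le\delta_{l_1,l_2}$ implies $u\in A^{l_2}$. Condition ($\Psi$): there exists a sequence of mappings $\{\psi_n\}\subset C(X,X)$ such that for every $n$ there exist $\alpha_n>\beta_n>0$ satisfying ($\Psi$1) $A(u)\ge\alpha_n A(\psi_n(u))$ and $B(u)\le\beta_n B(\psi_n(u))$ for all $u\in X$; ($\Psi$2) $\lim_{n\to\infty}\alpha_n=\lim_{n\to\infty}\beta_n=1$ and $\liminf_{n\to\infty}\dfrac{|1-\beta_n|}{\alpha_n-\beta_n}<\infty$. *)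

theory Defs
  imports "HOL-Analysis.Analysis"
begin

definition sublevel :: "('a \<Rightarrow> real) \<Rightarrow> real \<Rightarrow> 'a set" where
  "sublevel A l = {u. A u \<le> l}"

text \<open>The distance is taken in the extended reals, so that the distance to an empty sublevel
  set is infinite (unlike \<open>infdist\<close>, which is zero on the empty set).\<close>

definition dist_sublevel :: "('a::real_normed_vector \<Rightarrow> real) \<Rightarrow> real \<Rightarrow> 'a \<Rightarrow> ereal" where
  "dist_sublevel A l u = (INF h\<in>sublevel A l. ereal (norm (u - h)))"

definition condition_A :: "('a::real_normed_vector \<Rightarrow> real) \<Rightarrow> bool" where
  "condition_A A \<longleftrightarrow>
     (\<forall>u. 0 \<le> A u) \<and>
     (\<forall>l1 l2. 0 < l1 \<and> l1 < l2 \<longrightarrow>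
        (\<exists>\<delta>::real. \<delta> > 0 \<and> (\<forall>u. dist_sublevel A l1 u \<le> ereal \<delta> \<longrightarrow> u \<in> sublevel A l2)))"

text \<open>The sequence \<open>\<psi>\<close> is a parameter because it is referred to outside the condition.\<close>

definition condition_Psi ::
  "('a::real_normed_vector \<Rightarrow> real) \<Rightarrow> ('a \<Rightarrow> real) \<Rightarrow> (nat \<Rightarrow> 'a \<Rightarrow> 'a) \<Rightarrow> bool" where
  "condition_Psi A B \<psi> \<longleftrightarrow>
     (\<forall>n. continuous_on UNIV (\<psi> n)) \<and>
     (\<exists>\<alpha> \<beta> :: nat \<Rightarrow> real.
        (\<forall>n. \<alpha> n > \<beta> n \<and> \<beta> n > 0) \<and>
        (\<forall>n u. A u \<ge> \<alpha> n * A (\<psi> n u) \<and> B u \<le> \<beta> n * B (\<psi> n u)) \<and>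
        \<alpha> \<longlonglongrightarrow> 1 \<and> \<beta> \<longlonglongrightarrow> 1 \<and>
        liminf (\<lambda>n. ereal (\<bar>1 - \<beta> n\<bar> / (\<alpha> n - \<beta> n))) < \<infinity>)"

definition paths_to :: "'a::real_normed_vector \<Rightarrow> (real \<Rightarrow> 'a) set" where
  "paths_to v = {\<gamma>. continuous_on {0..1} \<gamma> \<and> \<gamma> 0 = 0 \<and> \<gamma> 1 = v}"

text \<open>For continuous \<open>I\<close> the inner supremum is a maximum, since \<open>\<gamma> ` {0..1}\<close> is compact, and
  the outer infimum is over a nonempty set bounded below by \<open>I 0\<close>; so both real-valued
  operators have their usual meaning.\<close>

definition mountain_pass_level :: "('a::real_normed_vector \<Rightarrow> real) \<Rightarrow> 'a \<Rightarrow> real" where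
  "mountain_pass_level I v = (INF \<gamma>\<in>paths_to v. SUP u\<in>\<gamma> ` {0..1}. I u)"

end

theory Submission
  imports Defs
begin

text \<open>
  The maps \<open>\<psi>\<^sub>n\<close> turn almost optimal paths into almost optimal paths on which \<open>A\<close> is bounded
  wherever \<open>I\<close> is near its maximum. Write \<open>c\<close> for the mountain pass level and let \<open>\<gamma>\<close> be a path
  on which \<open>I\<close> stays below \<open>c + \<eta>\<close>, where \<open>\<eta> = \<alpha>\<^sub>n - \<beta>\<^sub>n\<close>. Adding the two inequalities for \<open>\<psi>\<^sub>n\<close> gives
  \<open>\<eta> A(\<psi>\<^sub>n u) + \<beta>\<^sub>n I(\<psi>\<^sub>n u) \<le> I(u)\<close>. Since \<open>A\<close> is nonnegative, \<open>I\<close> is at most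
  \<open>(c + \<eta>) / \<beta>\<^sub>n\<close> on \<open>\<psi>\<^sub>n \<circ> \<gamma>\<close>, which is still close to \<open>c\<close>. At those points of
  \<open>\<psi>\<^sub>n \<circ> \<gamma>\<close> where \<open>I\<close> exceeds \<open>c - \<eta>\<close>, the same inequality bounds \<open>\<eta> A\<close> by
  \<open>(1 - \<beta>\<^sub>n) c + (1 + \<beta>\<^sub>n) \<eta>\<close>, hence \<open>A\<close> by \<open>L \<bar>c\<bar> + 3\<close> for the large ones
  among the infinitely many \<open>n\<close> with
  \<open>\<bar>1 - \<beta>\<^sub>n\<bar> \<le> L \<eta>\<close>. Short segments near \<open>0\<close> and \<open>ubar\<close>, on which \<open>I\<close> stays away from
  \<open>c\<close>, restore the end points. So there are almost optimal paths whose high points have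
  uniformly bounded \<open>A\<close> (\<open>bounded_almost_optimal_paths\<close>).

  It remains to find almost critical points near the high points of a given almost optimal
  path \<open>p\<close>; condition (A) then turns the bound on \<open>A\<close> at the high points into a bound at the
  almost critical points. This is \<open>localized_minimax_principle\<close>. Instead of a deformation by a
  pseudo-gradient flow, its proof uses Ekeland's variational principle for the maximum of \<open>I\<close>
  along paths. The minimization is restricted to paths \<open>q\<close> with \<open>I(q t) \<le> I(p t)\<close> for every
  \<open>t\<close>: since \<open>q\<close> is also uniformly close to \<open>p\<close>, every high point of \<open>q\<close> is then close to a
  high point of \<open>p\<close>, although \<open>I\<close> need not be uniformly continuous. If no high point of
  Ekeland's path were almost critical, a small step against a continuous field of directions of
  ascent along the path (\<open>ascent_field\<close>) would lower the maximum too fast.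
\<close>

section \<open>Ekeland's variational principle\<close>

text \<open>The relation "\<open>f y + \<sigma> dist x y \<le> f x\<close>" is a partial order whose lower sections \<open>S x\<close> are
  nested along a descending sequence. If each next term nearly minimizes \<open>f\<close> over the current
  section, the diameters of the sections shrink to zero, and the limit is a minimal element.
  Closedness of the sets \<open>{x\<in>E. f x \<le> a}\<close> combines lower semicontinuity of \<open>f\<close> with closedness
  of \<open>E\<close>; it puts the limit into every section.\<close>

lemma ekeland_variational_principle:
  fixes f :: "'x::complete_space \<Rightarrow> real"
  assumes lsc: "\<And>a. closed {x\<in>E. f x \<le> a}"
    and bdd: "bdd_below (f ` E)"
    and "x0 \<in> E" and "\<sigma> > 0"
  obtains x where "x \<in> E" and "f x + \<sigma> * dist x0 x \<le> f x0"
    and "\<And>y. y \<in> E \<Longrightarrow> f y + \<sigma> * dist x y \<le> f x \<Longrightarrow> y = x"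
proof -
  define S where "S x = {y\<in>E. f y + \<sigma> * dist x y \<le> f x}" for x
  have self: "x \<in> S x" if "x \<in> E" for x
    using that by (simp add: S_def)
  have S_subset: "S y \<subseteq> S x" if "y \<in> S x" for x y
  proof
    fix z assume "z \<in> S y"
    have "\<sigma> * dist x z \<le> \<sigma> * dist x y + \<sigma> * dist y z"
      using \<open>\<sigma> > 0\<close> dist_triangle[of x z y] by (simp flip: distrib_left)
    then show "z \<in> S x"
      using that \<open>z \<in> S y\<close> by (simp add: S_def)
  qed
  have "\<exists>y\<in>S x. \<forall>z\<in>S x. f y \<le> f z + (1/2)^n" if "x \<in> E" for x n
  proof -
    have "S x \<noteq> {}" "bdd_below (f ` S x)"
      using self[OF that] bdd by (auto simp: S_def intro: bdd_below_mono)
    moreover have "(INF z\<in>S x. f z) < (INF z\<in>S x. f z) + (1/2)^n"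
      by simp
    ultimately obtain y where "y \<in> S x" "f y < (INF z\<in>S x. f z) + (1/2)^n"
      using cINF_less_iff by metis
    moreover have "(INF z\<in>S x. f z) \<le> f z" if "z \<in> S x" for z
      using that \<open>bdd_below (f ` S x)\<close> by (rule cINF_lower[rotated])
    ultimately show ?thesis
      by (intro bexI[of _ y] ballI) (smt (verit))
  qed
  then obtain nxt where nxt: "\<And>x n. x \<in> E \<Longrightarrow> nxt x n \<in> S x"
      "\<And>x n z. x \<in> E \<Longrightarrow> z \<in> S x \<Longrightarrow> f (nxt x n) \<le> f z + (1/2)^n"
    by metis
  define X where "X = rec_nat x0 (\<lambda>n x. nxt x n)"
  have X0: "X 0 = x0" and XS: "\<And>n. X (Suc n) = nxt (X n) n"
    by (simp_all add: X_def)
  have XE: "X n \<in> E" for n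
    by (induction n) (use nxt(1) \<open>x0 \<in> E\<close> in \<open>auto simp: X0 XS S_def\<close>)
  have step: "X (Suc n) \<in> S (X n)" for n
    using nxt(1)[OF XE] by (simp add: XS)
  have later: "X (n + k) \<in> S (X n)" for n k
  proof (induction k)
    case (Suc k)
    then show ?case
      using S_subset step[of "n + k"] by auto
  qed (simp add: self XE)
  have close: "\<sigma> * dist (X (Suc n)) z \<le> (1/2)^n" if "z \<in> S (X (Suc n))" for n z
  proof -
    have "z \<in> S (X n)"
      using that S_subset[OF step] by blast
    then have "f (X (Suc n)) \<le> f z + (1/2)^n"
      using nxt(2)[OF XE] by (simp add: XS)
    then show ?thesis
      using that by (simp add: S_def)
  qed
  have small: "\<exists>n. (1/2)^n < \<sigma> * e" if "e > 0" for e :: real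
    using real_arch_pow_inv[of "\<sigma> * e" "1/2"] that \<open>\<sigma> > 0\<close> by simp
  have "Cauchy X"
  proof (rule metric_CauchyI)
    fix e :: real assume "e > 0"
    then obtain n where n: "(1/2)^n < \<sigma> * (e/2)"
      using small[of "e/2"] by auto
    have near: "dist (X (Suc n)) (X k) < e/2" if "k \<ge> Suc n" for k
    proof -
      have "\<sigma> * dist (X (Suc n)) (X k) < \<sigma> * (e/2)"
        using close[OF later[of "Suc n" "k - Suc n"]] that n by simp
      then show ?thesis
        using \<open>\<sigma> > 0\<close> by (simp only: mult_less_cancel_left_pos)
    qed
    have "dist (X j) (X k) < e" if "j \<ge> Suc n" "k \<ge> Suc n" for j k
      using near that dist_triangle_half_r by blast
    then show "\<exists>M. \<forall>m\<ge>M. \<forall>n\<ge>M. dist (X m) (X n) < e"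
      by blast
  qed
  then obtain x where lim: "X \<longlonglongrightarrow> x"
    using Cauchy_convergent convergent_def by blast
  have x_sub: "x \<in> E \<and> f x \<le> f (X n)" for n
  proof -
    have "X (k + n) \<in> {y\<in>E. f y \<le> f (X n)}" for k
    proof -
      have "0 \<le> \<sigma> * dist (X n) (X (n + k))"
        using \<open>\<sigma> > 0\<close> by simp
      then show ?thesis
        using later[of n k] by (simp add: S_def add.commute)
    qed
    moreover have "(\<lambda>k. X (k + n)) \<longlonglongrightarrow> x"
      using lim by (rule LIMSEQ_ignore_initial_segment)
    ultimately have "x \<in> {y\<in>E. f y \<le> f (X n)}"
      by (rule closed_sequentially[OF lsc])
    then show ?thesis
      by simp
  qed
  have x_S: "x \<in> S (X n)" for n
  proof -
    have "f x + \<sigma> * dist (X n) (X (k + n)) \<le> f (X n)" for k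
      using later[of n k] x_sub[of "k + n"] by (simp add: S_def add.commute)
    moreover have "(\<lambda>k. f x + \<sigma> * dist (X n) (X (k + n))) \<longlonglongrightarrow> f x + \<sigma> * dist (X n) x"
      by (intro tendsto_intros LIMSEQ_ignore_initial_segment lim)
    ultimately have "f x + \<sigma> * dist (X n) x \<le> f (X n)"
      by (intro LIMSEQ_le_const2) auto
    then show ?thesis
      using x_sub by (simp add: S_def)
  qed
  show thesis
  proof
    show "x \<in> E" "f x + \<sigma> * dist x0 x \<le> f x0"
      using x_S[of 0] by (simp_all add: S_def X0)
    fix y assume "y \<in> E" "f y + \<sigma> * dist x y \<le> f x"
    then have y: "y \<in> S (X n)" for n
      using S_subset[OF x_S] by (auto simp: S_def)
    have "dist x y \<le> 0"
    proof (rule ccontr)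
      assume "\<not> dist x y \<le> 0"
      then obtain n where n: "(1/2)^n < \<sigma> * (dist x y / 2)"
        using small[of "dist x y / 2"] by auto
      have "dist x y \<le> dist (X (Suc n)) x + dist (X (Suc n)) y"
        by (rule dist_triangle3)
      then have "\<sigma> * dist x y \<le> \<sigma> * dist (X (Suc n)) x + \<sigma> * dist (X (Suc n)) y"
        using \<open>\<sigma> > 0\<close> by (simp flip: distrib_left)
      also have "\<dots> \<le> (1/2)^n + (1/2)^n"
        using close[OF x_S] close[OF y] by (rule add_mono)
      finally show False
        using n by simp
    qed
    then show "y = x"
      by simp
  qed
qed

section \<open>Ascent directions along a compact family of points\<close>

text \<open>Stronger than uniform continuity on \<open>K\<close>, because \<open>y\<close> may leave \<open>K\<close>. In infinite dimension
  \<open>K\<close> has no compact neighbourhood to which uniform continuity could be applied; a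
  Lebesgue number of a suitable open cover of \<open>K\<close> does it.\<close>

lemma continuous_near_compact:
  fixes f :: "'x::metric_space \<Rightarrow> 'y::metric_space"
  assumes "continuous_on UNIV f" "compact K" "e > 0"
  obtains d where "d > 0" and "\<And>x y. x \<in> K \<Longrightarrow> dist x y < d \<Longrightarrow> dist (f y) (f x) < e"
proof -
  define G where "G z = f -` ball (f z) (e/2)" for z
  have "open (G z)" for z
    unfolding G_def using assms(1) by (intro open_vimage) auto
  then have "\<And>U. U \<in> G ` K \<Longrightarrow> open U" "K \<subseteq> \<Union>(G ` K)"
    using \<open>e > 0\<close> by (auto simp: G_def)
  then obtain d where d: "d > 0" "\<And>x. x \<in> K \<Longrightarrow> \<exists>U\<in>G ` K. ball x d \<subseteq> U"
    using Heine_Borel_lemma[OF \<open>compact K\<close>] by metis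
  show thesis
  proof (rule that[OF \<open>d > 0\<close>])
    fix x y assume "x \<in> K" "dist x y < d"
    then obtain z where "ball x d \<subseteq> G z"
      using d by blast
    then have "x \<in> G z" "y \<in> G z"
      using \<open>d > 0\<close> \<open>dist x y < d\<close> by auto
    then show "dist (f y) (f x) < e"
      unfolding G_def vimage_def by (simp add: dist_triangle_half_r)
  qed
qed

lemma blinfun_exceeds_on_unit_ball:
  fixes D :: "'x::real_normed_vector \<Rightarrow>\<^sub>L real"
  assumes "\<theta> < norm D" "0 \<le> \<theta>"
  shows "\<exists>v. norm v \<le> 1 \<and> \<theta> < D v"
proof (rule ccontr)
  assume neg: "\<not> (\<exists>v. norm v \<le> 1 \<and> \<theta> < D v)"
  have le: "D v \<le> \<theta>" if "norm v \<le> 1" for v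
    using neg that by force
  have "norm (D x) \<le> \<theta> * norm x" for x
  proof (cases "x = 0")
    case False
    have "D (x /\<^sub>R norm x) \<le> \<theta>" "D (- (x /\<^sub>R norm x)) \<le> \<theta>"
      using False by (intro le; simp)+
    then have "\<bar>D x\<bar> / norm x \<le> \<theta>"
      by (simp add: blinfun.bilinear_simps field_simps abs_if)
    then show ?thesis
      using False by (simp add: field_simps)
  qed (simp add: blinfun.bilinear_simps)
  then have "norm D \<le> \<theta>"
    using \<open>0 \<le> \<theta>\<close> by (intro norm_blinfun_bound)
  then show False
    using assms(1) by simp
qed

text \<open>The condition \<open>D t v > \<theta>\<close> is open in \<open>t\<close>, so a direction that works at one point works on a
  small ball. Finitely many such balls cover the compact set \<open>C\<close> of points at height at least
  \<open>m\<close>, and the sum of the directions, weighted by bumps supported in the balls, inherits the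
  linear inequality, with total weight \<open>a\<close>. The balls stay inside the region above height
  \<open>m'\<close>, so that the field vanishes below it without a separate cutoff. Recording the weight
  \<open>a\<close> lets later estimates compare the decrease with the displacement at every \<open>t\<close>.\<close>

lemma ascent_field:
  fixes D :: "'k::metric_space \<Rightarrow> 'x::real_normed_vector \<Rightarrow>\<^sub>L real" and f :: "'k \<Rightarrow> real"
  assumes "compact K" and contD: "continuous_on K D" and contf: "continuous_on K f"
    and "m' < m" and "0 \<le> \<theta>"
    and large: "\<And>t. t \<in> K \<Longrightarrow> m' < f t \<Longrightarrow> \<theta> < norm (D t)"
  obtains W :: "'k \<Rightarrow> 'x" and a :: "'k \<Rightarrow> real"
  where "continuous_on K W"
    and "\<And>t. t \<in> K \<Longrightarrow> 0 \<le> a t" "\<And>t. t \<in> K \<Longrightarrow> a t \<le> 1"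
    and "\<And>t. t \<in> K \<Longrightarrow> norm (W t) \<le> a t"
    and "\<And>t. t \<in> K \<Longrightarrow> \<theta> * a t \<le> D t (W t)"
    and "\<And>t. t \<in> K \<Longrightarrow> m \<le> f t \<Longrightarrow> a t = 1"
    and "\<And>t. t \<in> K \<Longrightarrow> f t \<le> m' \<Longrightarrow> a t = 0"
proof -
  define C where "C = {t\<in>K. m \<le> f t}"
  have "closedin (top_of_set K) C"
    using continuous_closedin_preimage[OF contf, of "{m..}"] by (auto simp: C_def Int_def)
  then have "compact C"
    using \<open>compact K\<close> closedin_compact by blast
  have "\<exists>v \<rho>. norm v \<le> 1 \<and> \<rho> > 0 \<and> (\<forall>t\<in>K. dist s t < \<rho> \<longrightarrow> m' < f t \<and> \<theta> < D t v)"
    if "s \<in> C" for s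
  proof -
    have s: "s \<in> K" "m' < f s"
      using that \<open>m' < m\<close> by (auto simp: C_def)
    obtain v where v: "norm v \<le> 1" "\<theta> < D s v"
      using blinfun_exceeds_on_unit_ball[OF large[OF s] \<open>0 \<le> \<theta>\<close>] by blast
    have "continuous_on K (\<lambda>t. D t v)"
      using contD by (intro continuous_intros)
    then have "((\<lambda>t. D t v) \<longlongrightarrow> D s v) (at s within K)" "(f \<longlongrightarrow> f s) (at s within K)"
      using contf s(1) by (auto simp: continuous_on)
    then have "\<forall>\<^sub>F t in at s within K. \<theta> < D t v \<and> m' < f t"
      using v s by (auto intro!: eventually_conj order_tendstoD)
    then obtain \<rho> where "\<rho> > 0" "\<forall>t\<in>K. t \<noteq> s \<and> dist t s < \<rho> \<longrightarrow> \<theta> < D t v \<and> m' < f t"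
      by (auto simp: eventually_at)
    then have "\<forall>t\<in>K. dist s t < \<rho> \<longrightarrow> m' < f t \<and> \<theta> < D t v"
      using v s by (metis dist_commute)
    then show ?thesis
      using v \<open>\<rho> > 0\<close> by blast
  qed
  then obtain v \<rho> where v: "\<And>s. s \<in> C \<Longrightarrow> norm (v s) \<le> 1"
    and \<rho>: "\<And>s. s \<in> C \<Longrightarrow> \<rho> s > 0"
    and near: "\<And>s t. s \<in> C \<Longrightarrow> t \<in> K \<Longrightarrow> dist s t < \<rho> s \<Longrightarrow> m' < f t \<and> \<theta> < D t (v s)"
    by metis
  have "C \<subseteq> (\<Union>s\<in>C. ball s (\<rho> s))"
    using \<rho> by fastforce
  then obtain S where S: "S \<subseteq> C" "finite S" "C \<subseteq> (\<Union>s\<in>S. ball s (\<rho> s))"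
    using compactE_image[OF \<open>compact C\<close>, of C "\<lambda>s. ball s (\<rho> s)"] by (metis open_ball)
  define bump where "bump s t = max 0 (\<rho> s - dist s t)" for s t
  define b where "b t = (\<Sum>s\<in>S. bump s t)" for t
  define V where "V t = (\<Sum>s\<in>S. bump s t *\<^sub>R v s)" for t
  have bump0: "0 \<le> bump s t" for s t
    by (simp add: bump_def)
  have contb: "continuous_on K b" and contV: "continuous_on K V"
    unfolding b_def V_def bump_def by (intro continuous_intros)+
  have b0: "0 \<le> b t" for t
    unfolding b_def by (intro sum_nonneg bump0)
  have b_pos: "0 < b t" if "t \<in> C" for t
  proof -
    obtain s where "s \<in> S" "dist s t < \<rho> s"
      using S(3) \<open>t \<in> C\<close> by (meson UN_E mem_ball subsetD)
    then have "0 < bump s t"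
      by (simp add: bump_def)
    then show ?thesis
      unfolding b_def using \<open>s \<in> S\<close> \<open>finite S\<close> bump0 by (intro sum_pos2[of S s]) auto
  qed
  have V_le: "norm (V t) \<le> b t" for t
    unfolding V_def b_def
  proof (rule sum_norm_le)
    fix s assume "s \<in> S"
    then show "norm (bump s t *\<^sub>R v s) \<le> bump s t"
      using v S(1) bump0[of s t] by (auto intro: mult_left_le)
  qed
  have DV: "\<theta> * b t \<le> D t (V t)" if "t \<in> K" for t
  proof -
    have "\<theta> * bump s t \<le> bump s t * D t (v s)" if "s \<in> S" for s
    proof (cases "dist s t < \<rho> s")
      case True
      then show ?thesis
        using near[of s t] \<open>s \<in> S\<close> S(1) \<open>t \<in> K\<close> bump0[of s t]
        by (subst mult.commute) (auto intro!: mult_left_mono)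
    qed (simp add: bump_def)
    then show ?thesis
      unfolding b_def V_def
      by (simp add: blinfun.bilinear_simps blinfun.sum_right sum_distrib_left sum_mono)
  qed
  have b_zero: "b t = 0" if "t \<in> K" "f t \<le> m'" for t
  proof -
    have "bump s t = 0" if "s \<in> S" for s
      using near[of s t] that S(1) \<open>t \<in> K\<close> \<open>f t \<le> m'\<close> by (force simp: bump_def)
    then show ?thesis
      by (simp add: b_def)
  qed
  obtain \<omega> where "\<omega> > 0" and \<omega>: "\<And>t. t \<in> C \<Longrightarrow> \<omega> \<le> b t"
  proof (cases "C = {}")
    case False
    have "continuous_on C b"
      using contb by (rule continuous_on_subset) (auto simp: C_def)
    then obtain t where "t \<in> C" "\<And>s. s \<in> C \<Longrightarrow> b t \<le> b s"
      using continuous_attains_inf[OF \<open>compact C\<close> False] by blast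
    then show ?thesis
      using that b_pos by blast
  qed (use that[of 1] in auto)
  \<comment> \<open>Dividing by \<open>max (b t) \<omega>\<close> turns the weight into \<open>1\<close> on \<open>C\<close> and keeps it at most \<open>1\<close>
    elsewhere, without a division by zero where \<open>b\<close> vanishes.\<close>
  define q where "q t = inverse (max (b t) \<omega>)" for t
  have q: "0 < q t" "q t * b t \<le> 1" for t
    using \<open>\<omega> > 0\<close> by (auto simp: q_def field_simps less_max_iff_disj)
  show thesis
  proof (rule that[of "\<lambda>t. q t *\<^sub>R V t" "\<lambda>t. q t * b t"])
    show "continuous_on K (\<lambda>t. q t *\<^sub>R V t)"
      unfolding q_def using contb contV \<open>\<omega> > 0\<close> by (intro continuous_intros) (auto simp: max_def)
    fix t assume "t \<in> K"
    show "0 \<le> q t * b t" "q t * b t \<le> 1"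
      using q[of t] b0[of t] by simp_all
    show "norm (q t *\<^sub>R V t) \<le> q t * b t"
      using q[of t] V_le[of t] by simp
    have "q t * (\<theta> * b t) \<le> q t * D t (V t)"
      using q(1)[of t] DV[OF \<open>t \<in> K\<close>] by (simp add: mult_left_mono)
    then show "\<theta> * (q t * b t) \<le> D t (q t *\<^sub>R V t)"
      by (simp add: blinfun.bilinear_simps mult.left_commute)
    show "q t * b t = 1" if "m \<le> f t"
      using \<omega>[of t] that \<open>t \<in> K\<close> \<open>\<omega> > 0\<close> by (simp add: C_def q_def max_def)
    show "q t * b t = 0" if "f t \<le> m'"
      using b_zero[OF \<open>t \<in> K\<close> that] by simp
  qed
qed

text \<open>First-order expansion, with one step length \<open>d\<close> for all of \<open>K\<close>: near \<open>K\<close> the derivative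
  differs from its value on \<open>K\<close> by at most \<open>\<theta> / 2\<close>, which costs half of the decrease that the
  linear term promises.\<close>

lemma C1_decrease_near_compact:
  fixes I :: "'x::real_normed_vector \<Rightarrow> real" and I' :: "'x \<Rightarrow> 'x \<Rightarrow>\<^sub>L real"
  assumes deriv: "\<And>u. (I has_derivative blinfun_apply (I' u)) (at u)"
    and cont: "continuous_on UNIV I'" and "compact K" and "\<theta> > 0"
  obtains d where "d > 0"
    and "\<And>u w a \<tau>. u \<in> K \<Longrightarrow> norm w \<le> a \<Longrightarrow> a \<le> 1 \<Longrightarrow> \<theta> * a \<le> I' u w \<Longrightarrow> 0 \<le> \<tau> \<Longrightarrow> \<tau> < d \<Longrightarrow>
           I (u - \<tau> *\<^sub>R w) \<le> I u - \<tau> * (\<theta> / 2) * a"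
proof -
  obtain d where d: "d > 0" "\<And>x y. x \<in> K \<Longrightarrow> dist x y < d \<Longrightarrow> dist (I' y) (I' x) < \<theta> / 2"
    using continuous_near_compact[OF cont \<open>compact K\<close>, of "\<theta> / 2"] \<open>\<theta> > 0\<close> by auto
  show thesis
  proof (rule that[OF \<open>d > 0\<close>])
    fix u w :: 'x and a \<tau> :: real
    assume *: "u \<in> K" "norm w \<le> a" "a \<le> 1" "\<theta> * a \<le> I' u w" "0 \<le> \<tau>" "\<tau> < d"
    have "norm (\<tau> *\<^sub>R w) \<le> \<tau> * 1"
      using * by (simp add: mult_left_le)
    have in_ball: "u + t *\<^sub>R ((u - \<tau> *\<^sub>R w) - u) \<in> ball u d" if "t \<in> {0..1}" for t
    proof -
      have "t * norm (\<tau> *\<^sub>R w) \<le> 1 * norm (\<tau> *\<^sub>R w)"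
        using that by (intro mult_right_mono) auto
      then show ?thesis
        using that \<open>norm (\<tau> *\<^sub>R w) \<le> \<tau> * 1\<close> \<open>\<tau> < d\<close> by (simp add: dist_norm abs_mult mult.assoc)
    qed
    have "norm (I (u - \<tau> *\<^sub>R w) - I u - I' u ((u - \<tau> *\<^sub>R w) - u)) \<le> norm ((u - \<tau> *\<^sub>R w) - u) * (\<theta> / 2)"
    proof (rule differentiable_bound_linearization[where S="ball u d" and f'="\<lambda>x. blinfun_apply (I' x)"])
      fix x assume "x \<in> ball u d"
      then have "norm (I' x - I' u) < \<theta> / 2"
        using d(2)[OF \<open>u \<in> K\<close>] by (simp add: dist_norm)
      then show "onorm (blinfun_apply (I' x) - blinfun_apply (I' u)) \<le> \<theta> / 2"
        by (simp add: norm_blinfun.rep_eq minus_blinfun.rep_eq fun_diff_def)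
    qed (use in_ball deriv \<open>d > 0\<close> in \<open>auto intro: has_derivative_at_withinI\<close>)
    then have "I (u - \<tau> *\<^sub>R w) - I u + \<tau> * I' u w \<le> \<tau> * norm w * (\<theta> / 2)"
      using * by (simp add: blinfun.bilinear_simps abs_le_iff del: le_divide_eq_numeral1 divide_le_eq_numeral1)
    moreover have "\<tau> * norm w * (\<theta> / 2) \<le> \<tau> * a * (\<theta> / 2)"
      using * \<open>\<theta> > 0\<close> by (intro mult_right_mono mult_left_mono) auto
    moreover have "\<tau> * (\<theta> * a) \<le> \<tau> * I' u w"
      using * by (intro mult_left_mono)
    ultimately show "I (u - \<tau> *\<^sub>R w) \<le> I u - \<tau> * (\<theta> / 2) * a"
      by (simp add: algebra_simps)
  qed
qed

section \<open>Almost critical points near an almost optimal path\<close>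

text \<open>An almost critical point near a high point of a given almost optimal path. The constants
  balance in Ekeland's principle with slope \<open>\<theta> / 2\<close>: the excess \<open>\<kappa>\<close> of the path's maximum over
  \<open>c\<close> allows a displacement of at most \<open>2 * \<kappa> / \<theta>\<close>, and a step against the ascent
  field would lower the maximum at the rate \<open>\<theta> / 2\<close>, which Ekeland's minimality forbids.\<close>

lemma localized_minimax_principle:
  fixes I :: "'a::banach \<Rightarrow> real" and I' :: "'a \<Rightarrow> 'a \<Rightarrow>\<^sub>L real"
  assumes deriv: "\<And>u. (I has_derivative blinfun_apply (I' u)) (at u)"
    and cont: "continuous_on UNIV I'"
    and "\<epsilon> > 0" "\<theta> > 0" and "path p"
    and ends: "I (pathstart p) \<le> c - \<epsilon>" "I (pathfinish p) \<le> c - \<epsilon>"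
    and upper: "\<And>u. u \<in> path_image p \<Longrightarrow> I u \<le> c + \<kappa>"
    and minimax: "\<And>q. path q \<Longrightarrow> pathstart q = pathstart p \<Longrightarrow> pathfinish q = pathfinish p \<Longrightarrow>
                   \<exists>u\<in>path_image q. c \<le> I u"
  shows "\<exists>x\<in>path_image p. \<exists>u. c - \<epsilon> < I x \<and> c - \<epsilon> < I u \<and> I u \<le> c + \<kappa> \<and>
           dist x u \<le> 2 * \<kappa> / \<theta> \<and> norm (I' u) \<le> \<theta>"
proof (rule ccontr)
  assume no: "\<not> ?thesis"
  have neg: "\<theta> < norm (I' u)"
    if "x \<in> path_image p" "c - \<epsilon> < I x" "c - \<epsilon> < I u" "I u \<le> c + \<kappa>" "dist x u \<le> 2 * \<kappa> / \<theta>" for x u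
    using no that by (meson not_le)
  define T where "T = {0..1::real}"
  have T: "compact T" "T \<noteq> {}" "0 \<in> T" "1 \<in> T"
    by (auto simp: T_def)
  have contI: "continuous_on S I" for S
    using deriv by (meson has_derivative_continuous continuous_at_imp_continuous_on)
  obtain P :: "real \<Rightarrow>\<^sub>C 'a" where P: "\<And>t. t \<in> T \<Longrightarrow> P t = p t"
    using continuous_on_cbox_bcontfunE[of 0 1 p] \<open>path p\<close>
    unfolding path_def T_def cbox_interval by metis
  define \<Phi> where "\<Phi> q = (SUP t\<in>T. I (apply_bcontfun q t))" for q
  \<comment> \<open>The pointwise constraint on \<open>I\<close> ties high points of \<open>q\<close> to high points of \<open>p\<close> with the
    same parameter. Bounded continuous functions on the whole line serve as the complete space of
    paths; their values outside \<open>T\<close> are left free.\<close>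
  define E where "E = {q. apply_bcontfun q 0 = p 0 \<and> apply_bcontfun q 1 = p 1 \<and> (\<forall>t\<in>T. I (apply_bcontfun q t) \<le> I (p t))}"
  have bdd: "bdd_above ((\<lambda>t. I (apply_bcontfun q t)) ` T)" for q
    using T(1) by (intro bounded_imp_bdd_above compact_imp_bounded compact_continuous_image
        continuous_on_compose2[OF contI]) auto
  have \<Phi>_le: "\<Phi> q \<le> a \<longleftrightarrow> (\<forall>t\<in>T. I (apply_bcontfun q t) \<le> a)" for q a
    unfolding \<Phi>_def using T(2) bdd by (rule cSUP_le_iff)
  have le_\<Phi>: "I (apply_bcontfun q t) \<le> \<Phi> q" if "t \<in> T" for q t
    using iffD1[OF \<Phi>_le order_refl] that by (rule bspec)
  have cont_eval: "continuous_on UNIV (\<lambda>q :: real \<Rightarrow>\<^sub>C 'a. apply_bcontfun q t)" for t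
    unfolding continuous_on_iff using dist_bounded le_less_trans by blast
  have closed: "closed {q\<in>E. \<Phi> q \<le> a}" for a
  proof -
    have "{q\<in>E. \<Phi> q \<le> a} = {q. apply_bcontfun q 0 = p 0} \<inter> {q. apply_bcontfun q 1 = p 1} \<inter>
        (\<Inter>t\<in>T. {q. I (apply_bcontfun q t) \<le> I (p t)} \<inter> {q. I (apply_bcontfun q t) \<le> a})"
      by (auto simp: E_def \<Phi>_le)
    also have "closed \<dots>"
      by (intro closed_Int closed_INT ballI closed_Collect_le closed_Collect_eq cont_eval
          continuous_on_const continuous_on_compose2[OF contI cont_eval]) auto
    finally show ?thesis .
  qed
  have c_le: "c \<le> \<Phi> q" if "q \<in> E" for q
  proof -
    have "path (apply_bcontfun q)" "pathstart q = pathstart p" "pathfinish q = pathfinish p"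
      using that by (auto simp: E_def path_def pathstart_def pathfinish_def)
    from minimax[OF this] obtain t where t: "t \<in> T" "c \<le> I (q t)"
      by (auto simp: path_image_def T_def)
    show ?thesis
      using t(2) le_\<Phi>[OF t(1)] by (rule order_trans)
  qed
  have "P \<in> E"
    using P T by (simp add: E_def)
  have "bdd_below (\<Phi> ` E)"
    using c_le by (rule bdd_belowI2)
  moreover have "\<theta> / 2 > 0"
    using \<open>\<theta> > 0\<close> by simp
  ultimately obtain Q where Q: "Q \<in> E" "\<Phi> Q + \<theta> / 2 * dist P Q \<le> \<Phi> P"
    and minimal: "\<And>R. R \<in> E \<Longrightarrow> \<Phi> R + \<theta> / 2 * dist Q R \<le> \<Phi> Q \<Longrightarrow> R = Q"
    using ekeland_variational_principle[OF closed _ \<open>P \<in> E\<close>, of "\<theta> / 2"] by metis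
  have "\<Phi> P \<le> c + \<kappa>"
    using upper P by (auto simp: \<Phi>_le path_image_def T_def)
  moreover have "0 \<le> \<theta> / 2 * dist P Q"
    using \<open>\<theta> > 0\<close> by simp
  ultimately have "\<theta> / 2 * dist P Q \<le> \<kappa>" and Q_upper: "\<Phi> Q \<le> c + \<kappa>"
    using Q(2) c_le[OF Q(1)] by linarith+
  then have "dist P Q \<le> 2 * \<kappa> / \<theta>"
    using \<open>\<theta> > 0\<close> by (simp add: field_simps)
  have large: "\<theta> < norm (I' (Q t))" if "t \<in> T" "c - \<epsilon> < I (Q t)" for t
  proof (rule neg)
    show "p t \<in> path_image p"
      using that by (auto simp: path_image_def T_def)
    show "c - \<epsilon> < I (p t)"
      using that Q(1) by (force simp: E_def)
    show "I (Q t) \<le> c + \<kappa>"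
      using Q_upper that by (simp add: \<Phi>_le)
    show "dist (p t) (Q t) \<le> 2 * \<kappa> / \<theta>"
      using dist_bounded[of P t Q] \<open>dist P Q \<le> 2 * \<kappa> / \<theta>\<close> P that by simp
  qed (use that in simp)
  have contI'Q: "continuous_on T (\<lambda>t. I' (Q t))"
    by (intro continuous_on_compose2[OF cont]) auto
  have contIQ: "continuous_on T (\<lambda>t. I (Q t))"
    by (intro continuous_on_compose2[OF contI]) auto
  have "c - \<epsilon> < c - \<epsilon> / 2" "0 \<le> \<theta>"
    using \<open>\<epsilon> > 0\<close> \<open>\<theta> > 0\<close> by auto
  from ascent_field[OF T(1) contI'Q contIQ this large]
  obtain W a where contW: "continuous_on T W"
    and a: "\<And>t. t \<in> T \<Longrightarrow> 0 \<le> a t" "\<And>t. t \<in> T \<Longrightarrow> a t \<le> 1"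
    and W: "\<And>t. t \<in> T \<Longrightarrow> norm (W t) \<le> a t" "\<And>t. t \<in> T \<Longrightarrow> \<theta> * a t \<le> I' (Q t) (W t)"
    and a_high: "\<And>t. t \<in> T \<Longrightarrow> c - \<epsilon> / 2 \<le> I (Q t) \<Longrightarrow> a t = 1"
    and a_low: "\<And>t. t \<in> T \<Longrightarrow> I (Q t) \<le> c - \<epsilon> \<Longrightarrow> a t = 0"
    by blast
  obtain V :: "real \<Rightarrow>\<^sub>C 'a" where V: "\<And>t. t \<in> T \<Longrightarrow> V t = W t" "\<And>t. V t = W (clamp 0 1 t)"
    using continuous_on_cbox_bcontfunE[of 0 1 W] contW unfolding T_def cbox_interval by metis
  have V_le: "norm (V t) \<le> 1" for t
  proof -
    have "clamp 0 1 t \<in> T"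
      using clamp_in_interval[of 0 "1::real" t] by (simp add: T_def)
    then show ?thesis
      unfolding V(2) using W(1) a(2) by (meson order_trans)
  qed
  have "compact (Q ` T)"
    using T(1) by (intro compact_continuous_image) auto
  from C1_decrease_near_compact[OF deriv cont this \<open>\<theta> > 0\<close>]
  obtain d where "d > 0"
    and d: "\<And>u w a \<tau>. u \<in> Q ` T \<Longrightarrow> norm w \<le> a \<Longrightarrow> a \<le> 1 \<Longrightarrow> \<theta> * a \<le> I' u w \<Longrightarrow> 0 \<le> \<tau> \<Longrightarrow> \<tau> < d \<Longrightarrow>
           I (u - \<tau> *\<^sub>R w) \<le> I u - \<tau> * (\<theta> / 2) * a"
    by metis
  \<comment> \<open>The bound \<open>\<epsilon> / \<theta>\<close> keeps the lowered maximum above the points of height less than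
    \<open>c - \<epsilon> / 2\<close>, where the field has no guaranteed strength.\<close>
  define \<tau> where "\<tau> = min (d / 2) (\<epsilon> / \<theta>)"
  have \<tau>: "0 < \<tau>" "\<tau> < d" "\<tau> * \<theta> \<le> \<epsilon>"
    using \<open>d > 0\<close> \<open>\<epsilon> > 0\<close> \<open>\<theta> > 0\<close> by (auto simp: \<tau>_def min_def field_simps)
  define R where "R = Q - \<tau> *\<^sub>R V"
  have R: "R t = Q t - \<tau> *\<^sub>R V t" for t
    by (simp add: R_def minus_bcontfun.rep_eq scaleR_bcontfun.rep_eq)
  have IR: "I (R t) \<le> I (Q t) - \<tau> * (\<theta> / 2) * a t" if "t \<in> T" for t
    using d[of "Q t" "W t" "a t" \<tau>] that W a V(1) \<tau> by (simp add: R)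
  have IR_le: "I (R t) \<le> I (Q t)" if "t \<in> T" for t
  proof -
    have "0 \<le> \<tau> * (\<theta> / 2) * a t"
      using \<tau>(1) \<open>\<theta> > 0\<close> a(1)[OF that] by simp
    then show ?thesis
      using IR[OF that] by linarith
  qed
  have fixed: "R t = Q t" if "t \<in> T" "I (Q t) \<le> c - \<epsilon>" for t
    using W(1)[OF that(1)] a_low[OF that] V(1)[OF that(1)] by (simp add: R)
  have "R \<in> E"
  proof -
    have "R 0 = p 0" "R 1 = p 1"
      using fixed[OF T(3)] fixed[OF T(4)] Q(1) ends by (auto simp: E_def pathstart_def pathfinish_def)
    moreover have "I (R t) \<le> I (p t)" if "t \<in> T" for t
      using IR_le[OF that] Q(1) that by (force simp: E_def)
    ultimately show ?thesis
      by (simp add: E_def)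
  qed
  \<comment> \<open>High points go down by the full step, and points lower than
    \<open>c - \<epsilon> / 2\<close> need not go down at all.\<close>
  have "\<Phi> R \<le> \<Phi> Q - \<tau> * (\<theta> / 2)"
    unfolding \<Phi>_le
  proof
    fix t assume "t \<in> T"
    show "I (R t) \<le> \<Phi> Q - \<tau> * (\<theta> / 2)"
    proof (cases "c - \<epsilon> / 2 \<le> I (Q t)")
      case True
      then show ?thesis
        using IR[OF \<open>t \<in> T\<close>] a_high[OF \<open>t \<in> T\<close>] le_\<Phi>[OF \<open>t \<in> T\<close>, of Q] by simp
    next
      case False
      then show ?thesis
        using IR_le[OF \<open>t \<in> T\<close>] c_le[OF Q(1)] \<tau>(3) by simp
    qed
  qed
  moreover have "dist Q R \<le> \<tau>"
    using V_le \<tau>(1) by (intro dist_bound) (simp add: R dist_norm mult_left_le)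
  then have "\<theta> / 2 * dist Q R \<le> \<theta> / 2 * \<tau>"
    using \<open>\<theta> > 0\<close> by (intro mult_left_mono) auto
  ultimately have "R = Q"
    by (intro minimal[OF \<open>R \<in> E\<close>]) (simp add: algebra_simps)
  moreover have "0 < \<tau> * (\<theta> / 2)"
    using \<tau>(1) \<open>\<theta> > 0\<close> by simp
  ultimately show False
    using \<open>\<Phi> R \<le> \<Phi> Q - \<tau> * (\<theta> / 2)\<close> by simp
qed

section \<open>The mountain pass level\<close>

lemma path_from_0_meets_sphere:
  fixes q :: "real \<Rightarrow> 'a::real_normed_vector"
  assumes "path q" "pathstart q = 0" "0 \<le> r" "r \<le> norm (pathfinish q)"
  shows "\<exists>u\<in>path_image q. norm u = r"
proof -
  have "continuous_on {0..1} (\<lambda>t. norm (q t))"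
    using \<open>path q\<close> by (auto simp: path_def intro: continuous_intros)
  then obtain t where "0 \<le> t" "t \<le> 1" "norm (q t) = r"
    using IVT'[of "\<lambda>t. norm (q t)" 0 r 1] assms by (auto simp: pathstart_def pathfinish_def)
  then show ?thesis
    by (auto simp: path_image_def)
qed

lemma paths_to_iff: "q \<in> paths_to v \<longleftrightarrow> path q \<and> pathstart q = 0 \<and> pathfinish q = v"
  by (simp add: paths_to_def path_def pathstart_def pathfinish_def)

lemma max_on_path:
  fixes I :: "'a::real_normed_vector \<Rightarrow> real"
  assumes "continuous_on UNIV I" "path q"
  shows "\<exists>u\<in>path_image q. I u = (SUP u\<in>q ` {0..1}. I u) \<and> (\<forall>x\<in>path_image q. I x \<le> I u)"
proof -
  have "compact (path_image q)" "path_image q \<noteq> {}"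
    using \<open>path q\<close> by auto
  then obtain u where "u \<in> path_image q" "\<forall>x\<in>path_image q. I x \<le> I u"
    using continuous_attains_sup continuous_on_subset[OF assms(1)] by blast
  moreover from this have "(SUP u\<in>path_image q. I u) = I u"
    by (intro cSup_eq_maximum) auto
  ultimately show ?thesis
    by (auto simp: path_image_def)
qed

text \<open>Every admissible path crosses the sphere of radius \<open>r\<close>. Besides the lower bound for the level,
  this shows that the infimum defining it is over a set bounded below, so that the infimum is
  a genuine one and can be approximated.\<close>

lemma mountain_pass_level_facts:
  fixes I :: "'a::real_normed_vector \<Rightarrow> real"
  assumes cont: "continuous_on UNIV I" and "0 \<le> r" "r \<le> norm v"
    and sphere: "\<And>u. norm u = r \<Longrightarrow> b \<le> I u"
  shows mountain_pass_level_ge: "b \<le> mountain_pass_level I v"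
    and mountain_pass_level_le_on_path: "\<And>q. q \<in> paths_to v \<Longrightarrow> \<exists>u\<in>path_image q. mountain_pass_level I v \<le> I u"
    and mountain_pass_level_approx: "\<And>e. e > 0 \<Longrightarrow>
      \<exists>q\<in>paths_to v. \<forall>u\<in>path_image q. I u < mountain_pass_level I v + e"
proof -
  define m where "m q = (SUP u\<in>q ` {0..1}. I u)" for q :: "real \<Rightarrow> 'a"
  have level: "mountain_pass_level I v = (INF q\<in>paths_to v. m q)"
    by (simp add: mountain_pass_level_def m_def)
  have m: "\<exists>u\<in>path_image q. I u = m q \<and> (\<forall>x\<in>path_image q. I x \<le> I u)" if "q \<in> paths_to v" for q
    unfolding m_def using that by (intro max_on_path[OF cont]) (simp add: paths_to_iff)
  have b_le: "b \<le> m q" if "q \<in> paths_to v" for q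
  proof -
    obtain x where "x \<in> path_image q" "norm x = r"
      using path_from_0_meets_sphere[of q r] \<open>q \<in> paths_to v\<close> assms(2,3) by (metis paths_to_iff)
    then have "b \<le> I x" "I x \<le> m q"
      using m[OF that] sphere by auto
    then show ?thesis
      by simp
  qed
  have bdd: "bdd_below (m ` paths_to v)"
    using b_le by (rule bdd_belowI2)
  have ne: "paths_to v \<noteq> {}"
    using paths_to_iff[of "linepath 0 v"] by auto
  show "b \<le> mountain_pass_level I v"
    unfolding level using ne b_le by (rule cINF_greatest)
  show "\<exists>u\<in>path_image q. mountain_pass_level I v \<le> I u" if "q \<in> paths_to v" for q
    using m[OF that] cINF_lower[OF bdd that] unfolding level by metis
  show "\<exists>q\<in>paths_to v. \<forall>u\<in>path_image q. I u < mountain_pass_level I v + e" if "e > 0" for e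
  proof -
    obtain q where "q \<in> paths_to v" "m q < mountain_pass_level I v + e"
      using cINF_less_iff[OF ne bdd, of "mountain_pass_level I v + e"] \<open>e > 0\<close> unfolding level by auto
    then show ?thesis
      using m[of q] le_less_trans by metis
  qed
qed

lemma frequently_le_of_liminf_finite:
  fixes x :: "nat \<Rightarrow> real"
  assumes "liminf (\<lambda>n. ereal (x n)) < \<infinity>"
  obtains L where "\<exists>\<^sub>F n in sequentially. x n \<le> L"
proof -
  obtain L where L: "liminf (\<lambda>n. ereal (x n)) < ereal L"
    using ereal_dense2[OF assms] by blast
  have "\<exists>\<^sub>F n in sequentially. x n \<le> L"
  proof (rule ccontr)
    assume "\<not> ?thesis"
    then have "\<forall>\<^sub>F n in sequentially. L < x n"
      by (simp add: not_frequently not_le)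
    then have "\<forall>\<^sub>F n in sequentially. ereal L \<le> ereal (x n)"
      by (rule eventually_mono) simp
    then show False
      using Liminf_bounded L by (metis not_le)
  qed
  then show thesis
    by (rule that)
qed

section \<open>Almost optimal paths with bounded high points\<close>

text \<open>Composing a nearly optimal path with \<open>\<psi>\<^sub>n\<close> trades a small loss in the maximum of \<open>I\<close> for a
  bound on \<open>A\<close> at the high points. The optimality gap of the original path has to be of the order
  of \<open>\<alpha>\<^sub>n - \<beta>\<^sub>n\<close>, since the bound on \<open>A\<close> comes from dividing by this difference.\<close>

lemma bounded_almost_optimal_paths:
  fixes I A B :: "'a::real_normed_vector \<Rightarrow> real"
  assumes cont: "continuous_on UNIV I" and I: "\<And>u. I u = A u - B u"
    and A0: "\<And>u. 0 \<le> A u" and Psi: "condition_Psi A B \<psi>"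
    and ends: "I 0 < c" "I v < c"
    and approx: "\<And>e. e > 0 \<Longrightarrow> \<exists>q\<in>paths_to v. \<forall>u\<in>path_image q. I u < c + e"
    and \<psi>0: "(\<lambda>n. norm (\<psi> n 0)) \<longlonglongrightarrow> 0"
    and \<psi>v: "(\<lambda>n. norm (\<psi> n v - v)) \<longlonglongrightarrow> 0"
  obtains M where "M > 0"
    and "\<And>\<kappa> \<epsilon>. \<kappa> > 0 \<Longrightarrow> \<epsilon> > 0 \<Longrightarrow> \<exists>p \<eta>. p \<in> paths_to v \<and> 0 < \<eta> \<and> \<eta> < \<epsilon> \<and>
           (\<forall>u\<in>path_image p. I u \<le> c + \<kappa> \<and> (c - \<eta> < I u \<longrightarrow> A u \<le> M))"
proof -
  from Psi obtain \<alpha> \<beta> :: "nat \<Rightarrow> real" where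
    cont\<psi>: "\<And>n. continuous_on UNIV (\<psi> n)" and
    \<beta>: "\<And>n. 0 < \<beta> n" "\<And>n. \<beta> n < \<alpha> n" and
    A: "\<And>n u. \<alpha> n * A (\<psi> n u) \<le> A u" and B: "\<And>n u. B u \<le> \<beta> n * B (\<psi> n u)" and
    lim: "\<alpha> \<longlonglongrightarrow> 1" "\<beta> \<longlonglongrightarrow> 1" and
    liminf: "liminf (\<lambda>n. ereal (\<bar>1 - \<beta> n\<bar> / (\<alpha> n - \<beta> n))) < \<infinity>"
    unfolding condition_Psi_def by blast
  from frequently_le_of_liminf_finite[OF liminf]
  obtain L where L: "\<exists>\<^sub>F n in sequentially. \<bar>1 - \<beta> n\<bar> / (\<alpha> n - \<beta> n) \<le> L" .
  define M where "M = \<bar>L\<bar> * \<bar>c\<bar> + 3"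
  have "M > 0"
    by (simp add: M_def add_nonneg_pos)
  \<comment> \<open>The end points are lower than \<open>c\<close> by at least \<open>2 * \<zeta>\<close>; half of this gap is reserved for
    the segments that join them to their images under \<open>\<psi>\<^sub>n\<close>.\<close>
  define \<zeta> where "\<zeta> = min (c - I 0) (c - I v) / 2"
  have "\<zeta> > 0" "I 0 < c - \<zeta>" "I v < c - \<zeta>"
    using ends by (auto simp: \<zeta>_def min_def field_simps)
  have "open {u. I u < c - \<zeta>}"
    using cont by (intro open_Collect_less) auto
  then have "\<exists>\<rho>>0. ball x \<rho> \<subseteq> {u. I u < c - \<zeta>}" if "I x < c - \<zeta>" for x
    using that by (simp add: open_contains_ball)
  then obtain \<rho>0 \<rho>v where \<rho>: "\<rho>0 > 0" "ball 0 \<rho>0 \<subseteq> {u. I u < c - \<zeta>}"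
      "\<rho>v > 0" "ball v \<rho>v \<subseteq> {u. I u < c - \<zeta>}"
    using \<open>I 0 < c - \<zeta>\<close> \<open>I v < c - \<zeta>\<close> by meson
  \<comment> \<open>The combination of the two inequalities for \<open>\<psi>\<^sub>n\<close> in which \<open>B\<close> occurs only as part of \<open>I\<close>;
    the gap \<open>\<alpha>\<^sub>n - \<beta>\<^sub>n\<close> remains as the coefficient of \<open>A\<close>.\<close>
  have key: "(\<alpha> n - \<beta> n) * A (\<psi> n u) + \<beta> n * I (\<psi> n u) \<le> I u" for n u
    using A[of n u] B[of u n] by (simp add: I algebra_simps)
  show thesis
  proof (rule that[OF \<open>M > 0\<close>])
    fix \<kappa> \<epsilon> :: real assume "\<kappa> > 0" "\<epsilon> > 0"
    have "(\<lambda>n. \<alpha> n - \<beta> n) \<longlonglongrightarrow> 1 - 1"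
      by (intro tendsto_intros lim)
    then have "\<forall>\<^sub>F n in sequentially. \<alpha> n - \<beta> n < min \<epsilon> \<zeta>"
      using \<open>\<epsilon> > 0\<close> \<open>\<zeta> > 0\<close> by (intro order_tendstoD) auto
    moreover have "(\<lambda>n. (c + (\<alpha> n - \<beta> n)) / \<beta> n) \<longlonglongrightarrow> (c + (1 - 1)) / 1"
      by (intro tendsto_intros lim) auto
    then have "\<forall>\<^sub>F n in sequentially. (c + (\<alpha> n - \<beta> n)) / \<beta> n < c + \<kappa>"
      using \<open>\<kappa> > 0\<close> by (intro order_tendstoD) auto
    moreover have "\<forall>\<^sub>F n in sequentially. \<beta> n < 2"
      using lim(2) by (rule order_tendstoD) auto
    moreover have "\<forall>\<^sub>F n in sequentially. norm (\<psi> n 0) < \<rho>0" "\<forall>\<^sub>F n in sequentially. norm (\<psi> n v - v) < \<rho>v"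
      using order_tendstoD(2)[OF \<psi>0 \<rho>(1)] order_tendstoD(2)[OF \<psi>v \<rho>(3)] by simp_all
    ultimately have "\<forall>\<^sub>F n in sequentially. \<alpha> n - \<beta> n < min \<epsilon> \<zeta> \<and> (c + (\<alpha> n - \<beta> n)) / \<beta> n < c + \<kappa> \<and>
        \<beta> n < 2 \<and> norm (\<psi> n 0) < \<rho>0 \<and> norm (\<psi> n v - v) < \<rho>v"
      by eventually_elim auto
    from frequently_ex[OF frequently_eventually_frequently[OF L this]]
    obtain n where n: "\<bar>1 - \<beta> n\<bar> / (\<alpha> n - \<beta> n) \<le> L" "\<alpha> n - \<beta> n < \<epsilon>" "\<alpha> n - \<beta> n < \<zeta>"
        "(c + (\<alpha> n - \<beta> n)) / \<beta> n < c + \<kappa>" "\<beta> n < 2" "norm (\<psi> n 0) < \<rho>0" "norm (\<psi> n v - v) < \<rho>v"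
      by auto
    define \<eta> where "\<eta> = \<alpha> n - \<beta> n"
    have "\<eta> > 0"
      using \<beta> by (simp add: \<eta>_def)
    then obtain q where q: "q \<in> paths_to v" "\<And>u. u \<in> path_image q \<Longrightarrow> I u < c + \<eta>"
      using approx by blast
    define p where "p = linepath 0 (\<psi> n 0) +++ ((\<psi> n \<circ> q) +++ linepath (\<psi> n v) v)"
    have "path (\<psi> n \<circ> q)"
      using q(1) cont\<psi> by (auto simp: paths_to_iff intro: path_continuous_image continuous_on_subset)
    moreover have "pathstart (\<psi> n \<circ> q) = \<psi> n 0" "pathfinish (\<psi> n \<circ> q) = \<psi> n v"
      using q(1) by (auto simp: paths_to_iff pathstart_compose pathfinish_compose)
    ultimately have p: "p \<in> paths_to v"
      "path_image p \<subseteq> closed_segment 0 (\<psi> n 0) \<union> \<psi> n ` path_image q \<union> closed_segment (\<psi> n v) v"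
      by (auto simp: p_def paths_to_iff path_image_join path_image_compose)
    have on_segments: "I u < c - \<zeta>" if "u \<in> closed_segment 0 (\<psi> n 0) \<union> closed_segment (\<psi> n v) v" for u
    proof -
      have "closed_segment 0 (\<psi> n 0) \<subseteq> ball 0 \<rho>0" "closed_segment (\<psi> n v) v \<subseteq> ball v \<rho>v"
        by (rule closed_segment_subset; use n \<rho> in \<open>simp add: dist_norm norm_minus_commute\<close>)+
      then show ?thesis
        using that \<rho> by blast
    qed
    have upper: "I (\<psi> n u) \<le> c + \<kappa>" if "u \<in> path_image q" for u
    proof -
      have "0 \<le> (\<alpha> n - \<beta> n) * A (\<psi> n u)"
        using \<beta>(2)[of n] A0 by simp
      then have "\<beta> n * I (\<psi> n u) < c + \<eta>"
        using key[of n u] q(2)[OF that] by linarith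
      then have "I (\<psi> n u) < (c + \<eta>) / \<beta> n"
        using \<beta>(1)[of n] by (simp add: field_simps)
      then show ?thesis
        using n(4) by (simp add: \<eta>_def)
    qed
    have bound: "A (\<psi> n u) \<le> M" if "u \<in> path_image q" "c - \<eta> < I (\<psi> n u)" for u
    proof -
      have "\<beta> n * (c - \<eta>) \<le> \<beta> n * I (\<psi> n u)"
        using \<beta>(1)[of n] that by simp
      then have "\<eta> * A (\<psi> n u) \<le> (1 - \<beta> n) * c + (1 + \<beta> n) * \<eta>"
        using key[of n u] q(2)[OF that(1)] by (simp add: \<eta>_def algebra_simps)
      also have "\<dots> \<le> \<bar>1 - \<beta> n\<bar> * \<bar>c\<bar> + 3 * \<eta>"
        using n(5) \<open>\<eta> > 0\<close> by (intro add_mono mult_right_mono) (simp_all flip: abs_mult)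
      also have "\<bar>1 - \<beta> n\<bar> * \<bar>c\<bar> \<le> (\<bar>L\<bar> * \<eta>) * \<bar>c\<bar>"
      proof -
        have "\<bar>1 - \<beta> n\<bar> / \<eta> \<le> \<bar>L\<bar>"
          using n(1) by (simp add: \<eta>_def)
        then have "\<bar>1 - \<beta> n\<bar> \<le> \<bar>L\<bar> * \<eta>"
          using \<open>\<eta> > 0\<close> by (simp add: pos_divide_le_eq)
        then show ?thesis
          by (intro mult_right_mono) auto
      qed
      finally have "\<eta> * A (\<psi> n u) \<le> \<eta> * M"
        by (simp add: M_def algebra_simps)
      then show ?thesis
        using \<open>\<eta> > 0\<close> by simp
    qed
    have "I u \<le> c + \<kappa> \<and> (c - \<eta> < I u \<longrightarrow> A u \<le> M)" if "u \<in> path_image p" for u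
    proof (cases "u \<in> \<psi> n ` path_image q")
      case True
      then show ?thesis
        using upper bound by blast
    next
      case False
      then have "I u < c - \<zeta>"
        using that p(2) on_segments by blast
      then show ?thesis
        using \<open>\<zeta> > 0\<close> \<open>\<kappa> > 0\<close> n(3) by (simp add: \<eta>_def)
    qed
    then show "\<exists>p \<eta>. p \<in> paths_to v \<and> 0 < \<eta> \<and> \<eta> < \<epsilon> \<and>
        (\<forall>u\<in>path_image p. I u \<le> c + \<kappa> \<and> (c - \<eta> < I u \<longrightarrow> A u \<le> M))"
      using p(1) \<open>\<eta> > 0\<close> n(2) unfolding \<eta>_def by blast
  qed
qed

section \<open>The mountain pass theorem\<close>

text \<open>A point of the sublevel set itself witnesses that the distance to the set is small.\<close>

lemma condition_A_near:
  assumes "condition_A A" "0 < l1" "l1 < l2"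
  obtains \<delta> where "\<delta> > 0" "\<And>x u. A x \<le> l1 \<Longrightarrow> dist x u \<le> \<delta> \<Longrightarrow> A u \<le> l2"
proof -
  have "\<exists>\<delta>::real. \<delta> > 0 \<and> (\<forall>u. dist_sublevel A l1 u \<le> ereal \<delta> \<longrightarrow> u \<in> sublevel A l2)"
    using assms by (simp add: condition_A_def)
  then obtain \<delta> :: real
    where \<delta>: "\<delta> > 0" "\<And>u. dist_sublevel A l1 u \<le> ereal \<delta> \<Longrightarrow> u \<in> sublevel A l2"
    by blast
  show thesis
  proof (rule that[OF \<delta>(1)])
    fix x u assume "A x \<le> l1" "dist x u \<le> \<delta>"
    then have "dist_sublevel A l1 u \<le> ereal (norm (u - x))"
      unfolding dist_sublevel_def by (intro INF_lower) (simp add: sublevel_def)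
    also have "\<dots> \<le> ereal \<delta>"
      using \<open>dist x u \<le> \<delta>\<close> by (simp add: dist_norm norm_minus_commute)
    finally have "u \<in> sublevel A l2"
      by (rule \<delta>(2))
    then show "A u \<le> l2"
      by (simp add: sublevel_def)
  qed
qed

theorem theorem1p1:
  fixes I A B :: "'a::banach \<Rightarrow> real"
    and I' :: "'a \<Rightarrow> ('a \<Rightarrow>\<^sub>L real)"
    and \<psi> :: "nat \<Rightarrow> 'a \<Rightarrow> 'a"
    and r :: real and ubar :: 'a
  assumes "\<And>u. (I has_derivative blinfun_apply (I' u)) (at u)"
    and "continuous_on UNIV I'"
    and "\<And>u. I u = A u - B u"
    and "condition_A A"
    and "condition_Psi A B \<psi>"
    and "r > 0" and "norm ubar > r"
    and "(INF u\<in>{u. norm u = r}. ereal (I u)) > ereal (I 0)"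
    and "I 0 \<ge> I ubar"
    and "(\<lambda>n. norm (\<psi> n 0)) \<longlonglongrightarrow> 0"
    and "(\<lambda>n. norm (\<psi> n ubar - ubar)) \<longlonglongrightarrow> 0"
  shows "\<exists>w :: nat \<Rightarrow> 'a.
           (\<lambda>n. I (w n)) \<longlonglongrightarrow> mountain_pass_level I ubar \<and>
           (\<lambda>n. I' (w n)) \<longlonglongrightarrow> 0 \<and>
           (SUP n. ereal (A (w n))) < \<infinity>"
proof -
  define c where "c = mountain_pass_level I ubar"
  have contI: "continuous_on UNIV I"
    using assms(1) by (meson has_derivative_continuous continuous_at_imp_continuous_on)
  obtain b where b: "I 0 < b" "ereal b < (INF u\<in>{u. norm u = r}. ereal (I u))"
    using ereal_dense2[OF assms(8)] by auto
  have sphere: "b \<le> I u" if "norm u = r" for u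
    using less_le_trans[OF b(2) INF_lower[of u]] that by force
  have r: "0 \<le> r" "r \<le> norm ubar"
    using assms(6,7) by auto
  note level = mountain_pass_level_facts[OF contI r sphere, folded c_def]
  have ends: "I 0 < c" "I ubar < c"
    using level(1) b(1) assms(9) by auto
  have "\<And>u. 0 \<le> A u"
    using assms(4) by (simp add: condition_A_def)
  from bounded_almost_optimal_paths[OF contI assms(3) this assms(5) ends level(3) assms(10,11)]
  obtain M where "M > 0" and
    paths: "\<And>\<kappa> \<epsilon>. \<kappa> > 0 \<Longrightarrow> \<epsilon> > 0 \<Longrightarrow> \<exists>p \<eta>. p \<in> paths_to ubar \<and> 0 < \<eta> \<and> \<eta> < \<epsilon> \<and>
           (\<forall>u\<in>path_image p. I u \<le> c + \<kappa> \<and> (c - \<eta> < I u \<longrightarrow> A u \<le> M))"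
    by metis
  obtain \<delta> where "\<delta> > 0" and \<delta>: "\<And>x u. A x \<le> M \<Longrightarrow> dist x u \<le> \<delta> \<Longrightarrow> A u \<le> M + 1"
    using condition_A_near[OF assms(4) \<open>M > 0\<close>, of "M + 1"] less_add_one by metis
  have almost_critical: "\<exists>u. A u \<le> M + 1 \<and> \<bar>I u - c\<bar> \<le> \<theta> \<and> norm (I' u) \<le> \<theta>" if "\<theta> > 0" for \<theta>
  proof -
    \<comment> \<open>The excess \<open>\<kappa>\<close> is chosen so that the displacement \<open>2 * \<kappa> / \<theta>\<close> of the minimax principle
      stays within the radius \<open>\<delta>\<close> that condition (A) allows.\<close>
    define \<kappa> where "\<kappa> = min \<theta> (\<theta> * \<delta> / 2)"
    have \<kappa>: "\<kappa> > 0" "\<kappa> \<le> \<theta>" "2 * \<kappa> / \<theta> \<le> \<delta>"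
      using that \<open>\<delta> > 0\<close> by (auto simp: \<kappa>_def min_def field_simps)
    have "min \<theta> (c - I 0) > 0"
      using \<open>\<theta> > 0\<close> ends(1) by simp
    from paths[OF \<open>\<kappa> > 0\<close> this] obtain p \<eta>
      where p: "p \<in> paths_to ubar" "0 < \<eta>" "\<eta> < min \<theta> (c - I 0)"
        "\<And>u. u \<in> path_image p \<Longrightarrow> I u \<le> c + \<kappa>"
        "\<And>u. u \<in> path_image p \<Longrightarrow> c - \<eta> < I u \<Longrightarrow> A u \<le> M"
      by blast
    have path: "path p" "pathstart p = 0" "pathfinish p = ubar"
      using p(1) by (simp_all add: paths_to_iff)
    have "\<exists>x\<in>path_image p. \<exists>u. c - \<eta> < I x \<and> c - \<eta> < I u \<and> I u \<le> c + \<kappa> \<and>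
        dist x u \<le> 2 * \<kappa> / \<theta> \<and> norm (I' u) \<le> \<theta>"
    proof (rule localized_minimax_principle[OF assms(1,2) \<open>0 < \<eta>\<close> \<open>0 < \<theta>\<close> path(1)])
      show "I (pathstart p) \<le> c - \<eta>" "I (pathfinish p) \<le> c - \<eta>"
        using p(3) path assms(9) by auto
      show "\<exists>u\<in>path_image q. c \<le> I u"
        if "path q" "pathstart q = pathstart p" "pathfinish q = pathfinish p" for q
        using that path level(2)[of q] by (simp add: paths_to_iff)
    qed (use p(4) in auto)
    then obtain x u where "x \<in> path_image p" "c - \<eta> < I x" "c - \<eta> < I u" "I u \<le> c + \<kappa>"
      "dist x u \<le> 2 * \<kappa> / \<theta>" "norm (I' u) \<le> \<theta>"
      by blast
    moreover from this have "A u \<le> M + 1"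
      using \<kappa>(3) by (intro \<delta>[of x u] p(5)) auto
    moreover have "\<eta> < \<theta>"
      using p(3) by simp
    ultimately show ?thesis
      using \<kappa>(2) by (intro exI[of _ u]) (simp add: abs_le_iff)
  qed
  have "\<exists>u. A u \<le> M + 1 \<and> \<bar>I u - c\<bar> \<le> inverse (Suc n) \<and> norm (I' u) \<le> inverse (Suc n)" for n
    by (rule almost_critical) simp
  then obtain w where w: "\<And>n. A (w n) \<le> M + 1" "\<And>n. \<bar>I (w n) - c\<bar> \<le> inverse (Suc n)"
      "\<And>n. norm (I' (w n)) \<le> inverse (Suc n)"
    by metis
  have "(\<lambda>n. I (w n) - c) \<longlonglongrightarrow> 0"
    by (rule tendsto_rabs_zero_cancel, rule tendsto_sandwich[OF _ _ tendsto_const LIMSEQ_inverse_real_of_nat])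
      (use w(2) in auto)
  moreover have "(\<lambda>n. I' (w n)) \<longlonglongrightarrow> 0"
    by (rule tendsto_norm_zero_cancel, rule tendsto_sandwich[OF _ _ tendsto_const LIMSEQ_inverse_real_of_nat])
      (use w(3) in auto)
  moreover have "(SUP n. ereal (A (w n))) \<le> ereal (M + 1)"
    using w(1) by (intro SUP_least) simp
  then have "(SUP n. ereal (A (w n))) < \<infinity>"
    by (rule le_less_trans) simp
  ultimately show ?thesis
    unfolding c_def by (intro exI[of _ w]) (simp add: LIM_zero_iff)
qed

end
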